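(* Let $k,r\in\mathbb{N}$ and $p\in\mathbb{N}_0=\{0,1,2,\ldots\}$, let $z=z(t)$ and $z_0=z_0(t)$ be meromorphic functions with at most logarithmic singularities, and let $x>0$ be such that all integrals below converge absolutely. Then $$\xi^{(x)}_{z_0}\left(\begin{array}{c}\{z\}_r\\ \{1\}_{r-1},k\end{array};\begin{array}{c}\{z\}_p\\ \{1\}_p\end{array}\right)=\sum_{j=1}^r\ \sum_{\substack{k_1+\cdots+k_j=k+j-1\\ k_1,\ldots,k_j\ge1}}(-1)^{j-1}\binom{p+r-j}{p}\,\xi^{(x)}_{z_0}\left(\begin{array}{c}\{z\}_j\\ k_1,\ldots,k_j\end{array};\begin{array}{c}\{z\}_{p+r-j}\\ \{1\}_{p+r-j}\end{array}\right)$$ and $$\sum_{\substack{k_1+\cdots+k_r=k+r-1\\ k_1,\ldots,k_r\ge1}}\xi^{(x)}_{z_0}\left(\begin{array}{c}\{z\}_r\\ k_1,\ldots,k_r\end{array};\begin{array}{c}\{z\}_p\\ \{1\}_p\end{array}\right)=\sum_{j=1}^r(-1)^{j-1}\binom{p+r-j}{p}\,\xi^{(x)}_{z_0}\left(\begin{array}{c}\{z\}_j\\ \{1\}_{j-1},k\end{array};\begin{array}{c}\{z\}_{p+r-j}\\ \{1\}_{p+r-j}\end{array}\right).$$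
   Context: $\mathbb{N}$ is the set of positive integers. $\{a\}_n$ means $a$ repeated $n$ times (nothing if $n=0$). "At most logarithmic singularities" means that the poles of the function are at most simple. Iterated integral: $\int_0^x f_1(t)dt\,f_2(t)dt\cdots f_n(t)dt:=\int_{0<t_1<\cdots<t_n<x}f_1(t_1)\cdots f_n(t_n)\,dt_1\cdots dt_n$. Formal multiple polylogarithm function: for functions $w_1,\ldots,w_d$ and positive integers $m_1,\ldots,m_d$, $$L_{z_0}\left(\begin{array}{c}w_1,\ldots,w_d\\ m_1,\ldots,m_d\end{array};x\right):=\int_0^x w_1(t)dt\,(z_0(t)dt)^{m_1-1}\cdots w_d(t)dt\,(z_0(t)dt)^{m_d-1},$$ where $(z_0(t)dt)^{m}$ denotes $m$ consecutive factors $z_0(t)dt$; for $d=0$ the value is $1$. General formal Arakawa–Kaneko zeta values: for a function $w$ and $p\ge0$, $$\xi^{(x)}_{z_0}\left(\begin{array}{c}w_1,\ldots,w_d\\ m_1,\ldots,m_d\end{array};\begin{array}{c}\{w\}_p\\ \{1\}_p\end{array}\right):=\int_0^x L_{z_0}\left(\begin{array}{c}\{w\}_p\\ \{1\}_p\end{array};t\right)z_0(t)\,L_{z_0}\left(\begin{array}{c}w_1,\ldots,w_d\\ m_1,\ldots,m_d\end{array};t\right)dt.$$ Convergence of the integrals includes absolute convergence of the inner iterated integrals $L_{z_0}(\cdots;t)$ for $0<t<x$. *)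

theory Defs
  imports "HOL-Analysis.Analysis" "HOL-Complex_Analysis.Complex_Analysis"
begin

definition log_sing_meromorphic :: "(complex \<Rightarrow> complex) \<Rightarrow> bool" where
  "log_sing_meromorphic f \<longleftrightarrow> f meromorphic_on UNIV \<and> (\<forall>a. is_pole f a \<longrightarrow> zorder f a = -1)"

(* The points of the simplex are written (u 0, ..., u (n - 1)) with u 0 innermost, i.e.
   0 < u 0 < ... < u (n - 1) < x. *)
definition open_simplex :: "nat \<Rightarrow> real \<Rightarrow> (nat \<Rightarrow> real) set" where
  "open_simplex n x =
     {u \<in> extensional {..<n}. (\<forall>i<n. 0 < u i \<and> u i < x) \<and> (\<forall>i<n. \<forall>j<n. i < j \<longrightarrow> u i < u j)}"

abbreviation lborel_n :: "nat \<Rightarrow> (nat \<Rightarrow> real) measure" where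
  "lborel_n n \<equiv> PiM {..<n} (\<lambda>_. lborel)"

(* The values of the integrands at their poles are irrelevant: on the real line these form a
   null set. *)
definition iter_integrand :: "(complex \<Rightarrow> complex) list \<Rightarrow> (nat \<Rightarrow> real) \<Rightarrow> complex" where
  "iter_integrand fs u = (\<Prod>i<length fs. (fs ! i) (complex_of_real (u i)))"

definition iter_integral :: "(complex \<Rightarrow> complex) list \<Rightarrow> real \<Rightarrow> complex" where
  "iter_integral fs x =
     (LINT u:open_simplex (length fs) x|lborel_n (length fs). iter_integrand fs u)"

(* Integrability in the sense of Lebesgue is absolute convergence. *)
definition iter_converges :: "(complex \<Rightarrow> complex) list \<Rightarrow> real \<Rightarrow> bool" where
  "iter_converges fs x \<longleftrightarrow>
     set_integrable (lborel_n (length fs)) (open_simplex (length fs) x) (iter_integrand fs)"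

(* The sequence of one-forms w_1 dt (z0 dt)^(m_1 - 1) ... w_d dt (z0 dt)^(m_d - 1); the lists
   of the w_i and of the m_i are meant to have the same length d, and the m_i to be positive. *)
definition polylog_word ::
  "(complex \<Rightarrow> complex) \<Rightarrow> (complex \<Rightarrow> complex) list \<Rightarrow> nat list \<Rightarrow> (complex \<Rightarrow> complex) list" where
  "polylog_word z0 ws ms = concat (map2 (\<lambda>w m. w # replicate (m - 1) z0) ws ms)"

definition formal_polylog ::
  "(complex \<Rightarrow> complex) \<Rightarrow> (complex \<Rightarrow> complex) list \<Rightarrow> nat list \<Rightarrow> real \<Rightarrow> complex" where
  "formal_polylog z0 ws ms x = iter_integral (polylog_word z0 ws ms) x"

definition formal_polylog_converges ::
  "(complex \<Rightarrow> complex) \<Rightarrow> (complex \<Rightarrow> complex) list \<Rightarrow> nat list \<Rightarrow> real \<Rightarrow> bool" where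
  "formal_polylog_converges z0 ws ms x \<longleftrightarrow> iter_converges (polylog_word z0 ws ms) x"

definition AK_integrand ::
  "(complex \<Rightarrow> complex) \<Rightarrow> (complex \<Rightarrow> complex) list \<Rightarrow> nat list \<Rightarrow> (complex \<Rightarrow> complex) \<Rightarrow> nat
    \<Rightarrow> real \<Rightarrow> complex" where
  "AK_integrand z0 ws ms w p t =
     formal_polylog z0 (replicate p w) (replicate p 1) t * z0 (complex_of_real t)
       * formal_polylog z0 ws ms t"

(* AK_zeta z0 x ws ms w p is the value with left column ws, ms and right column {w}_p, {1}_p. *)
definition AK_zeta ::
  "(complex \<Rightarrow> complex) \<Rightarrow> real \<Rightarrow> (complex \<Rightarrow> complex) list \<Rightarrow> nat list \<Rightarrow> (complex \<Rightarrow> complex) \<Rightarrow> nat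
    \<Rightarrow> complex" where
  "AK_zeta z0 x ws ms w p = (LINT t:{0<..<x}|lborel. AK_integrand z0 ws ms w p t)"

definition AK_converges ::
  "(complex \<Rightarrow> complex) \<Rightarrow> real \<Rightarrow> (complex \<Rightarrow> complex) list \<Rightarrow> nat list \<Rightarrow> (complex \<Rightarrow> complex) \<Rightarrow> nat
    \<Rightarrow> bool" where
  "AK_converges z0 x ws ms w p \<longleftrightarrow>
     (\<forall>t\<in>{0<..<x}. formal_polylog_converges z0 (replicate p w) (replicate p 1) t
                  \<and> formal_polylog_converges z0 ws ms t) \<and>
     set_integrable lborel {0<..<x} (AK_integrand z0 ws ms w p)"

definition compositions :: "nat \<Rightarrow> nat \<Rightarrow> nat list set" where
  "compositions j n = {ks. length ks = j \<and> sum_list ks = n \<and> (\<forall>m\<in>set ks. 1 \<le> m)}"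

lemma finite_compositions: "finite (compositions j n)"
proof (rule finite_subset)
  show "compositions j n \<subseteq> {ks. set ks \<subseteq> {..n} \<and> length ks = j}"
    by (auto simp: compositions_def intro: member_le_sum_list)
  show "finite {ks. set ks \<subseteq> {..n} \<and> length ks = j}"
    by (rule finite_lists_length_eq) simp
qed

(* Hence convergence of the values indexed by compositions covers the values with lower row
   1, ..., 1, k. *)
lemma ones_k_in_compositions:
  assumes "1 \<le> j" "1 \<le> k"
  shows "replicate (j - 1) 1 @ [k] \<in> compositions j (k + j - 1)"
  using assms by (auto simp: compositions_def sum_list_replicate)

lemma formal_polylog_Nil: "formal_polylog z0 [] [] x = 1"
proof -
  have *: "open_simplex 0 x = {\<lambda>_. undefined}"
    by (auto simp: open_simplex_def)
  show ?thesis
    by (simp add: * formal_polylog_def polylog_word_def iter_integral_def iter_integrand_def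
        set_lebesgue_integral_def PiM_empty lebesgue_integral_count_space_finite)
qed

end

(* Fix t < x. Let P n, S j and E j be the iterated integrals up to t of the word z^n, of the
   word z^j z0^(k-1), and the sum of those of all words with j letters z and k - 1 letters z0
   that begin with z. Then S r = sum_(1 <= j <= r) (-1)^(j-1) P (r-j) E j: on differentiating the
   right-hand side, the terms with factor z telescope and the terms with factor z0 give the same
   identity for k - 1. Since P a P b = C(a+b, a) P (a+b), the relation can be inverted, which
   exchanges S and E. Multiplying by P p z0(t) and integrating over t gives both formulas.

   The argument needs the convergence of the integrals of all words z^i with i < p + r, of which
   only the longest is given. A meromorphic z vanishes almost everywhere on the real line, and
   then everything is 0, or almost nowhere, and then the prefixes of z^(p+r-1) converge by
   Fubini. *)

theory Submission
  imports Defs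
begin

section \<open>Splitting off the outermost variable of an iterated integral\<close>

text \<open>It suffices to compare both measures on boxes. The new coordinate is put first in the
  pair, so that Fubini makes it the variable of the outer integral.\<close>

lemma (in product_sigma_finite) distr_pair_fun_upd:
  assumes I: "finite I" "i \<notin> I"
  shows "distr (M i \<Otimes>\<^sub>M PiM I M) (PiM (insert i I) M) (\<lambda>(y, u). u(i := y)) = PiM (insert i I) M"
    (is "distr ?N ?P ?f = ?P")
proof (rule PiM_eqI)
  interpret I: finite_product_sigma_finite M I by standard fact
  have f: "?f \<in> measurable ?N ?P"
    using measurable_compose[OF measurable_pair_swap' measurable_add_dim[of i I M]]
    by (simp add: case_prod_beta)
  show "finite (insert i I)" using I by simp
  show "sets (distr ?N ?P ?f) = sets ?P" by simp
  fix A assume A: "\<And>j. j \<in> insert i I \<Longrightarrow> A j \<in> sets (M j)"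
  have "?f -` Pi\<^sub>E (insert i I) A \<inter> space ?N = A i \<times> Pi\<^sub>E I A" (is "?L = ?R")
  proof (intro set_eqI iffI)
    fix q assume q: "q \<in> ?L"
    obtain y u where [simp]: "q = (y, u)" by (cases q)
    have "u(i := y) \<in> Pi\<^sub>E (insert i I) A" "u \<in> extensional I"
      using q by (auto simp: space_pair_measure space_PiM PiE_def)
    then show "q \<in> ?R" using I(2) by (auto simp: PiE_iff)  (metis fun_upd_other)+
  next
    fix q assume q: "q \<in> ?R"
    then show "q \<in> ?L" using I(2) A[THEN sets.sets_into_space]
      by (fastforce simp: PiE_iff space_pair_measure space_PiM extensional_def)
  qed
  then show "emeasure (distr ?N ?P ?f) (Pi\<^sub>E (insert i I) A) = (\<Prod>j\<in>insert i I. emeasure (M j) (A j))"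
    using I A by (subst emeasure_distr[OF f])
      (auto simp: I.emeasure_pair_measure_Times I.measure_times intro!: sets_PiM_I_finite)
qed

lemma space_lborel_n: "space (lborel_n n) = extensional {..<n}"
  by (simp add: space_PiM PiE_def)

text \<open>The last coordinate is the largest, so once it is fixed at \<open>s\<close> the bound
  \<open>t\<close> for the other coordinates is superseded by \<open>s\<close>. This makes iterated
  integrals recursive in the last letter.\<close>

lemma fun_upd_in_open_simplex:
  assumes "u \<in> extensional {..<n}"
  shows "u(n := s) \<in> open_simplex (Suc n) t \<longleftrightarrow> 0 < s \<and> s < t \<and> u \<in> open_simplex n s"
  using assms unfolding open_simplex_def
  by (auto simp: extensional_def less_Suc_eq dest: order.strict_trans split: if_splits)

lemma iter_integrand_snoc:
  "iter_integrand (fs @ [g]) (u(length fs := s)) = g (of_real s) * iter_integrand fs u"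
  by (simp add: iter_integrand_def nth_append lessThan_Suc mult.commute)

lemma sets_open_simplex [measurable]: "open_simplex n t \<in> sets (lborel_n n)"
proof -
  have "open_simplex n t = {u \<in> space (lborel_n n). (\<forall>i\<in>{..<n}. 0 < u i \<and> u i < t) \<and>
      (\<forall>i\<in>{..<n}. \<forall>j\<in>{..<n}. i < j \<longrightarrow> u i < u j)}"
    by (auto simp: open_simplex_def space_lborel_n)
  also have "\<dots> \<in> sets (lborel_n n)" by measurable
  finally show ?thesis .
qed

lemma open_simplex_mono: "s \<le> t \<Longrightarrow> open_simplex n s \<subseteq> open_simplex n t"
  by (auto simp: open_simplex_def)

lemma iter_converges_mono: "iter_converges fs t \<Longrightarrow> s \<le> t \<Longrightarrow> iter_converges fs s"
  unfolding iter_converges_def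
  by (erule set_integrable_subset) (use open_simplex_mono in auto)

text \<open>Fubini with the largest variable \<open>s\<close> outside: the section of the integrand
  at \<open>s\<close> is \<open>g s\<close> times the integrand of \<open>fs\<close> on the simplex
  of size \<open>s\<close>. Almost every section is integrable, but this says something about
  \<open>fs\<close> only after division by \<open>g s\<close>; hence the alternative
  \<open>g s = 0\<close>.\<close>

lemma
  assumes conv: "iter_converges (fs @ [g]) t"
  shows iter_converges_snoc_AE:
      "AE s in lborel. s \<in> {0<..<t} \<longrightarrow> g (of_real s) = 0 \<or> iter_converges fs s"
    and iter_integral_snoc_integrable:
      "set_integrable lborel {0<..<t} (\<lambda>s. g (of_real s) * iter_integral fs s)"
    and iter_integral_snoc:
      "iter_integral (fs @ [g]) t = (LINT s:{0<..<t}|lborel. g (of_real s) * iter_integral fs s)"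
proof -
  define n where "n = length fs"
  interpret product_sigma_finite "\<lambda>_::nat. lborel :: real measure" by standard
  interpret I: finite_product_sigma_finite "\<lambda>_::nat. lborel :: real measure" "{..<n}" by standard simp
  interpret pair_sigma_finite "lborel :: real measure" "lborel_n n" by standard
  let ?N = "lborel \<Otimes>\<^sub>M lborel_n n" and ?P = "lborel_n (Suc n)"
  let ?f = "\<lambda>(s::real, u). u(n := s)"
  define F where "F u = indicator (open_simplex (Suc n) t) u *\<^sub>R iter_integrand (fs @ [g]) u" for u
  define H where "H s u = (indicator {0<..<t} s *\<^sub>R g (of_real s)) *
      (indicator (open_simplex n s) u *\<^sub>R iter_integrand fs u)" for s :: real and u
  have distr: "distr ?N ?P ?f = ?P"
    using distr_pair_fun_upd[of "{..<n}" n] by (simp add: lessThan_Suc)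
  have f: "?f \<in> measurable ?N ?P"
    using measurable_compose[OF measurable_pair_swap' measurable_add_dim[of n "{..<n}" "\<lambda>_. lborel"]]
    by (simp add: case_prod_beta lessThan_Suc)
  have F: "integrable ?P F"
    using conv by (simp add: iter_converges_def F_def[abs_def] set_integrable_def n_def)
  have FH: "F (u(n := s)) = H s u" if "u \<in> space (lborel_n n)" for s u
    using that fun_upd_in_open_simplex[of u n s t] iter_integrand_snoc[of fs g u s]
    by (auto simp: F_def H_def space_lborel_n indicator_def n_def)
  have "integrable ?N (\<lambda>q. F (?f q))"
    using F distr by (intro integrable_distr[OF f]) simp
  also have "?this \<longleftrightarrow> integrable ?N (case_prod H)"
    by (intro Bochner_Integration.integrable_cong) (auto simp: space_pair_measure FH)
  finally have H: "integrable ?N (case_prod H)" .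
  \<comment> \<open>This holds for every \<open>s\<close>. If the integral of \<open>fs\<close>
    diverges, then for a nonzero factor both sides have the default value 0, and for the factor 0
    both sides vanish anyway.\<close>
  have inner: "(LINT u|lborel_n n. H s u) = indicator {0<..<t} s *\<^sub>R (g (of_real s) * iter_integral fs s)" for s
    unfolding H_def integral_mult_right_zero
    by (simp add: iter_integral_def set_lebesgue_integral_def n_def)
  show "AE s in lborel. s \<in> {0<..<t} \<longrightarrow> g (of_real s) = 0 \<or> iter_converges fs s"
    using AE_integrable_fst[OF H]
  proof eventually_elim
    fix s assume Hs: "integrable (lborel_n n) (H s)"
    show "s \<in> {0<..<t} \<longrightarrow> g (of_real s) = 0 \<or> iter_converges fs s"
      unfolding disj_imp
    proof (intro impI)
      assume s: "s \<in> {0<..<t}" and g: "g (of_real s) \<noteq> 0"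
      have "(\<lambda>u. inverse (g (of_real s)) * H s u) =
          (\<lambda>u. indicator (open_simplex n s) u *\<^sub>R iter_integrand fs u)"
        using s g by (auto simp: fun_eq_iff H_def)
      then show "iter_converges fs s"
        using integrable_mult_right[OF Hs, of "inverse (g (of_real s))"]
        by (simp add: iter_converges_def set_integrable_def n_def)
    qed
  qed
  show "set_integrable lborel {0<..<t} (\<lambda>s. g (of_real s) * iter_integral fs s)"
    using integrable_fst[OF H] by (simp add: set_integrable_def inner)
  have "iter_integral (fs @ [g]) t = integral\<^sup>L ?P F"
    by (simp add: iter_integral_def set_lebesgue_integral_def F_def[abs_def] n_def)
  also have "\<dots> = integral\<^sup>L ?N (\<lambda>q. F (?f q))"
    using F by (subst distr[symmetric], subst integral_distr[OF f]) auto
  also have "\<dots> = integral\<^sup>L ?N (case_prod H)"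
    by (intro Bochner_Integration.integral_cong) (auto simp: space_pair_measure FH)
  also have "\<dots> = (LINT s|lborel. LINT u|lborel_n n. H s u)"
    using integral_fst[OF H] by simp
  finally show "iter_integral (fs @ [g]) t = (LINT s:{0<..<t}|lborel. g (of_real s) * iter_integral fs s)"
    by (simp add: inner set_lebesgue_integral_def)
qed

lemma iter_integral_Nil [simp]: "iter_integral [] t = 1"
  using formal_polylog_Nil[of undefined t] by (simp add: formal_polylog_def polylog_word_def)

section \<open>Primitives of integrable functions and the product rule\<close>

text \<open>A substitute for differentiation: \<open>f\<close> is merely integrable, so
  \<open>F\<close> need not be differentiable everywhere. The formula also forces the limit 0 at 0,
  so there are no constants of integration; in particular the constant 1, the integral of the empty
  word, is not a primitive of 0.\<close>

definition primitive :: "real \<Rightarrow> (real \<Rightarrow> complex) \<Rightarrow> (real \<Rightarrow> complex) \<Rightarrow> bool" where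
  "primitive t F f \<longleftrightarrow> set_integrable lborel {0<..<t} f \<and>
     (\<forall>s\<in>{0<..t}. F s = (LINT a:{0<..<s}|lborel. f a))"

lemma primitive_iter_integral:
  assumes "iter_converges (fs @ [g]) t"
  shows "primitive t (iter_integral (fs @ [g])) (\<lambda>s. g (of_real s) * iter_integral fs s)"
  using assms iter_converges_mono[OF assms]
  by (auto simp: primitive_def intro: iter_integral_snoc_integrable iter_integral_snoc)

lemma primitive_subset:
  assumes "primitive t F f" "s \<le> t"
  shows "set_integrable lborel {0<..<s} f"
  using assms by (auto simp: primitive_def intro: set_integrable_subset)

lemma primitive_zero: "primitive t (\<lambda>_. 0) (\<lambda>_. 0)"
  by (simp add: primitive_def set_integrable_def set_lebesgue_integral_def)

lemma primitive_add:
  assumes "primitive t F f" "primitive t G g"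
  shows "primitive t (\<lambda>s. F s + G s) (\<lambda>s. f s + g s)"
  using assms primitive_subset[OF assms(1)] primitive_subset[OF assms(2)]
  by (auto simp: primitive_def set_integral_add)

lemma primitive_cmult:
  assumes "primitive t F f"
  shows "primitive t (\<lambda>s. c * F s) (\<lambda>s. c * f s)"
  using assms by (auto simp: primitive_def)

lemma primitive_sum:
  assumes "\<And>i. i \<in> A \<Longrightarrow> primitive t (F i) (f i)"
  shows "primitive t (\<lambda>s. \<Sum>i\<in>A. F i s) (\<lambda>s. \<Sum>i\<in>A. f i s)"
  using assms by (induction A rule: infinite_finite_induct) (auto intro: primitive_zero primitive_add)

text \<open>The form in which identities are proved below: it is enough to compare densities, and
  only almost everywhere, which matches the almost-everywhere convergence that Fubini
  supplies.\<close>

lemma primitive_unique: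
  assumes "primitive t F f" "primitive t G g" "0 < t"
    and "AE s in lborel. s \<in> {0<..<t} \<longrightarrow> f s = g s"
  shows "F t = G t"
proof -
  have "(LINT a:{0<..<t}|lborel. f a) = (LINT a:{0<..<t}|lborel. g a)"
    using assms unfolding set_lebesgue_integral_def primitive_def set_integrable_def
    by (intro integral_cong_AE) (auto elim!: eventually_mono simp: indicator_def)
  then show ?thesis using assms by (simp add: primitive_def)
qed

text \<open>Integration by parts through Fubini: \<open>F s * G s\<close> is the integral of
  \<open>f a * g b\<close> over a square, which the diagonal cuts into two triangles. Integrating
  out the smaller variable first turns it into \<open>G a\<close> on one triangle and
  \<open>F b\<close> on the other.\<close>

lemma primitive_mult:
  assumes F: "primitive t F f" and G: "primitive t G g"
  shows "primitive t (\<lambda>s. F s * G s) (\<lambda>s. f s * G s + F s * g s)"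
proof -
  have F': "F s = (LINT a:{0<..<s}|lborel. f a)" if "s \<in> {0<..t}" for s
    using F that by (auto simp: primitive_def)
  have G': "G s = (LINT a:{0<..<s}|lborel. g a)" if "s \<in> {0<..t}" for s
    using G that by (auto simp: primitive_def)
  have *: "set_integrable lborel {0<..<s} (\<lambda>a. f a * G a) \<and>
      set_integrable lborel {0<..<s} (\<lambda>b. F b * g b) \<and>
      F s * G s = (LINT a:{0<..<s}|lborel. f a * G a) + (LINT b:{0<..<s}|lborel. F b * g b)"
    if s: "s \<in> {0<..t}" for s
  proof -
    define u where "u a = indicator {0<..<s} a *\<^sub>R f a" for a
    define v where "v b = indicator {0<..<s} b *\<^sub>R g b" for b
    have u: "integrable lborel u"
      using primitive_subset[OF F, of s] s by (auto simp: u_def[abs_def] set_integrable_def)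
    have v: "integrable lborel v"
      using primitive_subset[OF G, of s] s by (auto simp: v_def[abs_def] set_integrable_def)
    have uv: "integrable (lborel \<Otimes>\<^sub>M lborel) (\<lambda>(a, b). u a * v b)"
      using u v by (intro lborel_pair.Fubini_integrable)
        (auto simp: norm_mult intro!: integrable_mult_left integrable_mult_right)
    have open_sets: "A \<in> sets (lborel \<Otimes>\<^sub>M lborel)" if "open A" for A :: "(real \<times> real) set"
      using that unfolding lborel_prod by simp
    have lo: "integrable (lborel \<Otimes>\<^sub>M lborel) (\<lambda>(a, b). indicator {q. snd q < fst q} (a, b) *\<^sub>R (u a * v b))"
      using integrable_mult_indicator[OF open_sets uv, of "{q. snd q < fst q}"]
      by (simp add: split_beta' open_Collect_less continuous_on_fst continuous_on_snd)
    have hi: "integrable (lborel \<Otimes>\<^sub>M lborel) (\<lambda>(a, b). indicator {q. fst q < snd q} (a, b) *\<^sub>R (u a * v b))"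
      using integrable_mult_indicator[OF open_sets uv, of "{q. fst q < snd q}"]
      by (simp add: split_beta' open_Collect_less continuous_on_fst continuous_on_snd)
    have lo1: "(LINT b|lborel. indicator {q. snd q < fst q} (a, b) *\<^sub>R (u a * v b))
        = indicator {0<..<s} a *\<^sub>R (f a * G a)" for a
    proof (cases "a \<in> {0<..<s}")
      case True
      then have "(LINT b|lborel. indicator {q. snd q < fst q} (a, b) *\<^sub>R (u a * v b))
          = (LINT b|lborel. f a * (indicator {0<..<a} b *\<^sub>R g b))"
        by (intro Bochner_Integration.integral_cong) (auto simp: u_def v_def indicator_def)
      also have "\<dots> = f a * G a"
        unfolding integral_mult_right_zero using True s by (subst G') (auto simp: set_lebesgue_integral_def)
      finally show ?thesis using True by simp
    qed (auto simp: u_def)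
    have hi1: "(LINT a|lborel. indicator {q. fst q < snd q} (a, b) *\<^sub>R (u a * v b))
        = indicator {0<..<s} b *\<^sub>R (F b * g b)" for b
    proof (cases "b \<in> {0<..<s}")
      case True
      then have "(LINT a|lborel. indicator {q. fst q < snd q} (a, b) *\<^sub>R (u a * v b))
          = (LINT a|lborel. (indicator {0<..<b} a *\<^sub>R f a) * g b)"
        by (intro Bochner_Integration.integral_cong) (auto simp: u_def v_def indicator_def)
      also have "\<dots> = F b * g b"
        unfolding integral_mult_left_zero using True s by (subst F') (auto simp: set_lebesgue_integral_def)
      finally show ?thesis using True by simp
    qed (auto simp: v_def)
    have i1: "set_integrable lborel {0<..<s} (\<lambda>a. f a * G a)"
      using lborel_pair.integrable_fst[OF lo] by (simp add: lo1 set_integrable_def)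
    have i2: "set_integrable lborel {0<..<s} (\<lambda>b. F b * g b)"
      using lborel_pair.integrable_snd[OF hi] by (simp add: hi1 set_integrable_def)
    have "F s * G s = integral\<^sup>L lborel u * integral\<^sup>L lborel v"
      using s by (simp add: F' G' u_def[abs_def] v_def[abs_def] set_lebesgue_integral_def)
    also have "\<dots> = (LINT a|lborel. LINT b|lborel. u a * v b)"
      by simp
    also have "\<dots> = (LINT q|(lborel \<Otimes>\<^sub>M lborel). u (fst q) * v (snd q))"
      using lborel_pair.integral_fst[OF uv] by (simp add: split_beta')
    also have "\<dots> = (LINT q|(lborel \<Otimes>\<^sub>M lborel).
        (case q of (a, b) \<Rightarrow> indicator {q. snd q < fst q} (a, b) *\<^sub>R (u a * v b)) +
        (case q of (a, b) \<Rightarrow> indicator {q. fst q < snd q} (a, b) *\<^sub>R (u a * v b)))"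
    \<comment> \<open>The two open triangles miss only the diagonal, which is a null set.\<close>
    proof (rule integral_cong_AE)
      have "AE b in lborel. a \<noteq> b" for a :: real
        using AE_lborel_singleton[of a] by eventually_elim auto
      moreover have "{q. fst q \<noteq> (snd q :: real)} \<in> sets (lborel \<Otimes>\<^sub>M lborel)"
        by (intro open_sets open_Collect_neq continuous_intros)
      ultimately have "AE q in lborel \<Otimes>\<^sub>M lborel. fst q \<noteq> (snd q :: real)"
        by (intro lborel_pair.AE_pair_measure) (auto simp: space_pair_measure)
      then show "AE q in lborel \<Otimes>\<^sub>M lborel. u (fst q) * v (snd q) =
        (case q of (a, b) \<Rightarrow> indicator {q. snd q < fst q} (a, b) *\<^sub>R (u a * v b)) +
        (case q of (a, b) \<Rightarrow> indicator {q. fst q < snd q} (a, b) *\<^sub>R (u a * v b))"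
        by eventually_elim (auto simp: indicator_def)
    qed (use uv lo hi in \<open>auto simp: case_prod_beta\<close>)
    also have "\<dots> = (LINT a:{0<..<s}|lborel. f a * G a) + (LINT b:{0<..<s}|lborel. F b * g b)"
      using lo hi lborel_pair.integral_fst[OF lo] lborel_pair.integral_snd[OF hi]
      by (simp add: lo1 hi1 set_lebesgue_integral_def)
    finally show ?thesis using i1 i2 by simp
  qed
  show ?thesis
  proof (cases "0 < t")
    case True
    then show ?thesis using * by (auto simp: primitive_def set_integral_add)
  qed (auto simp: primitive_def set_integrable_def)
qed

section \<open>Words and compositions\<close>

text \<open>This is \<open>polylog_word\<close> with all upper entries equal to \<open>z\<close>.
  With one list instead of two, a word grows by changing the end of that list alone.\<close>

definition comp_word :: "(complex \<Rightarrow> complex) \<Rightarrow> (complex \<Rightarrow> complex) \<Rightarrow> nat list \<Rightarrow> (complex \<Rightarrow> complex) list" where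
  "comp_word z z0 ks = concat (map (\<lambda>m. z # replicate (m - 1) z0) ks)"

lemma polylog_word_replicate:
  "length ks = j \<Longrightarrow> polylog_word z0 (replicate j z) ks = comp_word z z0 ks"
  by (induction ks arbitrary: j) (auto simp: polylog_word_def comp_word_def)

lemma comp_word_replicate: "comp_word z z0 (replicate j (Suc 0)) = replicate j z"
  by (induction j) (auto simp: comp_word_def)

lemma comp_word_snoc: "comp_word z z0 (ks @ [Suc m]) = comp_word z z0 ks @ z # replicate m z0"
  by (simp add: comp_word_def)

lemma comp_word_ones_snoc:
  "comp_word z z0 (replicate j (Suc 0) @ [Suc m]) = replicate (Suc j) z @ replicate m z0"
  by (simp add: comp_word_snoc comp_word_replicate replicate_app_Cons_same)

lemma polylog_word_ones: "polylog_word z0 (replicate p z) (replicate p 1) = replicate p z"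
  by (simp add: polylog_word_replicate comp_word_replicate)

text \<open>On words this appends the letter \<open>z0\<close>, just as appending the entry 1 to the
  composition appends the letter \<open>z\<close>.\<close>

definition inc_last :: "nat list \<Rightarrow> nat list" where
  "inc_last ks = butlast ks @ [Suc (last ks)]"

lemma comp_word_inc_last:
  assumes "ks \<in> compositions (Suc j) n"
  shows "comp_word z z0 (inc_last ks) = comp_word z z0 ks @ [z0]"
proof -
  obtain ls l where ks: "ks = ls @ [Suc l]"
    using assms by (cases ks rule: rev_cases) (auto simp: compositions_def Suc_le_eq gr0_conv_Suc)
  show ?thesis by (simp add: ks inc_last_def comp_word_snoc replicate_append_same)
qed

lemma compositions_Suc_Suc:
  "compositions (Suc j) (Suc n) = (\<lambda>ks. ks @ [Suc 0]) ` compositions j n \<union> inc_last ` compositions (Suc j) n"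
  (is "?L = ?A \<union> ?B")
proof (intro set_eqI iffI)
  fix ks assume ks: "ks \<in> ?L"
  then obtain ls l where l: "ks = ls @ [Suc l]"
    by (cases ks rule: rev_cases) (auto simp: compositions_def Suc_le_eq gr0_conv_Suc)
  show "ks \<in> ?A \<union> ?B"
  proof (cases l)
    case 0
    with ks l have "ls \<in> compositions j n" by (auto simp: compositions_def)
    then show ?thesis using l 0 by auto
  next
    case (Suc l')
    with ks l have "ls @ [l] \<in> compositions (Suc j) n" "inc_last (ls @ [l]) = ks"
      by (auto simp: compositions_def inc_last_def)
    then show ?thesis by blast
  qed
next
  fix ks assume "ks \<in> ?A \<union> ?B"
  then show "ks \<in> ?L"
  proof
    assume "ks \<in> ?B"
    then obtain ks' where ks': "ks = inc_last ks'" "ks' \<in> compositions (Suc j) n" by auto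
    moreover obtain ls l where "ks' = ls @ [l]"
      using ks' by (cases ks' rule: rev_cases) (auto simp: compositions_def)
    ultimately show ?thesis by (auto simp: compositions_def inc_last_def)
  qed (auto simp: compositions_def)
qed

lemma sum_compositions_Suc_Suc:
  fixes f :: "nat list \<Rightarrow> 'a::comm_monoid_add"
  shows "sum f (compositions (Suc j) (Suc n)) =
    (\<Sum>ks\<in>compositions j n. f (ks @ [Suc 0])) + (\<Sum>ks\<in>compositions (Suc j) n. f (inc_last ks))"
proof -
  let ?A = "(\<lambda>ks. ks @ [Suc 0]) ` compositions j n" and ?B = "inc_last ` compositions (Suc j) n"
  have inj: "inj_on inc_last (compositions (Suc j) n)"
  proof (rule inj_onI)
    fix a b assume "a \<in> compositions (Suc j) n" "b \<in> compositions (Suc j) n" "inc_last a = inc_last b"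
    then have "a \<noteq> []" "b \<noteq> []" "butlast a = butlast b" "last a = last b"
      by (auto simp: compositions_def inc_last_def)
    then show "a = b" by (metis append_butlast_last_id)
  qed
  \<comment> \<open>Entries are positive, so a list from \<open>inc_last\<close> ends in at least 2
    and cannot also arise by appending 1.\<close>
  have "last ks > 0" if "ks \<in> compositions (Suc j) n" for ks
  proof -
    have "last ks \<in> set ks" using that by (intro last_in_set) (auto simp: compositions_def)
    then show ?thesis using that by (auto simp: compositions_def)
  qed
  then have "?A \<inter> ?B = {}" by (fastforce simp: inc_last_def)
  then show ?thesis
    unfolding compositions_Suc_Suc
    by (subst sum.union_disjoint) (auto simp: finite_compositions sum.reindex[OF inj] sum.reindex inj_on_def)
qed

lemma compositions_0_Suc: "compositions 0 (Suc n) = {}"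
  by (auto simp: compositions_def)

lemma compositions_self: "compositions j j = {replicate j (Suc 0)}"
proof (intro set_eqI iffI)
  fix ks assume ks: "ks \<in> compositions j j"
  have "length ks \<le> sum_list ks \<and> (sum_list ks = length ks \<longrightarrow> ks = replicate (length ks) (Suc 0))"
    if "\<forall>m\<in>set ks. 1 \<le> m" for ks :: "nat list"
    using that by (induction ks) auto
  with ks show "ks \<in> {replicate j (Suc 0)}" by (auto simp: compositions_def)
qed (auto simp: compositions_def sum_list_replicate)

text \<open>The sum of the iterated integrals of all words with \<open>j\<close> letters \<open>z\<close> and \<open>m\<close> letters
  \<open>z0\<close> whose first letter is \<open>z\<close>.\<close>

definition comp_sum :: "(complex \<Rightarrow> complex) \<Rightarrow> (complex \<Rightarrow> complex) \<Rightarrow> nat \<Rightarrow> nat \<Rightarrow> real \<Rightarrow> complex" where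
  "comp_sum z z0 j m t = (\<Sum>ks\<in>compositions j (m + j). iter_integral (comp_word z z0 ks) t)"

definition comp_converges :: "(complex \<Rightarrow> complex) \<Rightarrow> (complex \<Rightarrow> complex) \<Rightarrow> nat \<Rightarrow> nat \<Rightarrow> real \<Rightarrow> bool" where
  "comp_converges z z0 j m t \<longleftrightarrow> (\<forall>ks\<in>compositions j (m + j). iter_converges (comp_word z z0 ks) t)"

lemma comp_sum_0_Suc: "comp_sum z z0 0 (Suc m) t = 0"
  by (simp add: comp_sum_def compositions_0_Suc)

lemma comp_sum_0_right: "comp_sum z z0 j 0 t = iter_integral (replicate j z) t"
  by (simp add: comp_sum_def compositions_self comp_word_replicate)

text \<open>The word is that of the composition 1, ..., 1, m + 1.\<close>

lemma comp_converges_ones: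
  assumes "comp_converges z z0 (Suc j) m t"
  shows "iter_converges (replicate (Suc j) z @ replicate m z0) t"
proof -
  have "replicate j (Suc 0) @ [Suc m] \<in> compositions (Suc j) (m + Suc j)"
    by (auto simp: compositions_def sum_list_replicate)
  then show ?thesis
    using assms unfolding comp_converges_def comp_word_ones_snoc[symmetric] by blast
qed

lemma comp_convergesD:
  assumes "comp_converges z z0 (Suc j) (Suc m) t"
  shows "ks \<in> compositions j (Suc m + j) \<Longrightarrow> iter_converges (comp_word z z0 ks @ [z]) t"
    and "ks \<in> compositions (Suc j) (m + Suc j) \<Longrightarrow> iter_converges (comp_word z z0 ks @ [z0]) t"
proof -
  have *: "iter_converges (comp_word z z0 ks) t" if "ks \<in> compositions (Suc j) (Suc (m + Suc j))" for ks
    using assms that by (simp add: comp_converges_def)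
  show "iter_converges (comp_word z z0 ks @ [z]) t" if "ks \<in> compositions j (Suc m + j)"
    using *[of "ks @ [Suc 0]"] that comp_word_snoc[of z z0 ks 0]
    unfolding compositions_Suc_Suc[of j "m + Suc j"] by auto
  show "iter_converges (comp_word z z0 ks @ [z0]) t" if "ks \<in> compositions (Suc j) (m + Suc j)"
    using *[of "inc_last ks"] that comp_word_inc_last[OF that]
    unfolding compositions_Suc_Suc[of j "m + Suc j"] by auto
qed

text \<open>Differentiation removes the last letter, and the words are grouped by that letter. For
  \<open>j = 0\<close> the term with \<open>z\<close> vanishes, since a word that begins with
  \<open>z\<close> contains a \<open>z\<close>.\<close>

lemma primitive_comp_sum:
  assumes "comp_converges z z0 (Suc j) (Suc m) t"
  shows "primitive t (comp_sum z z0 (Suc j) (Suc m))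
    (\<lambda>s. z (of_real s) * comp_sum z z0 j (Suc m) s + z0 (of_real s) * comp_sum z z0 (Suc j) m s)"
proof -
  have "comp_sum z z0 (Suc j) (Suc m) = (\<lambda>s.
      (\<Sum>ks\<in>compositions j (Suc m + j). iter_integral (comp_word z z0 ks @ [z]) s) +
      (\<Sum>ks\<in>compositions (Suc j) (m + Suc j). iter_integral (comp_word z z0 ks @ [z0]) s))"
    by (auto simp: comp_sum_def sum_compositions_Suc_Suc comp_word_snoc comp_word_inc_last intro!: ext sum.cong)
  then show ?thesis
    using comp_convergesD[OF assms] unfolding comp_sum_def[of _ _ j] comp_sum_def[of _ _ _ m] sum_distrib_left
    by (auto intro!: primitive_add primitive_sum primitive_iter_integral)
qed

text \<open>There are finitely many words, and each contributes a null set of exceptions. Points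
  with \<open>z0 s = 0\<close> do no harm, because the sums with \<open>m\<close> letters
  \<open>z0\<close> will be used only after multiplication by \<open>z0 s\<close>.\<close>

lemma comp_converges_AE:
  assumes "comp_converges z z0 (Suc j) (Suc m) t"
  shows "AE s in lborel. s \<in> {0<..<t} \<longrightarrow> z0 (of_real s) = 0 \<or> comp_converges z z0 (Suc j) m s"
proof -
  have "AE s in lborel. \<forall>ks\<in>compositions (Suc j) (m + Suc j).
      s \<in> {0<..<t} \<longrightarrow> z0 (of_real s) = 0 \<or> iter_converges (comp_word z z0 ks) s"
    by (intro AE_finite_allI finite_compositions iter_converges_snoc_AE comp_convergesD[OF assms])
  then show ?thesis
    by eventually_elim (auto simp: comp_converges_def)
qed

section \<open>Products of the integrals of powers of \<open>z\<close>\<close>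

lemma replicate_Suc_snoc: "replicate (Suc n) a = replicate n a @ [a]"
  by (simp add: replicate_append_same)

lemma primitive_replicate:
  assumes "iter_converges (replicate (Suc n) z) t"
  shows "primitive t (iter_integral (replicate (Suc n) z))
    (\<lambda>s. z (of_real s) * iter_integral (replicate n z) s)"
  using assms unfolding replicate_Suc_snoc by (rule primitive_iter_integral)

text \<open>The shuffle product of two powers of one letter. By induction on \<open>a + b\<close>,
  the product rule lowers one exponent at a time, and comparing densities amounts to Pascal's rule.
  An empty factor is the constant 1, which is no \<open>primitive\<close>, so it is treated
  separately.\<close>

lemma iter_integral_replicate_mult:
  assumes "0 < t" "\<And>i. i \<le> a + b \<Longrightarrow> iter_converges (replicate i z) t"
  shows "iter_integral (replicate a z) t * iter_integral (replicate b z) t =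
    of_nat ((a + b) choose a) * iter_integral (replicate (a + b) z) t"
  using assms
proof (induction "a + b" arbitrary: a b t)
  case (Suc n)
  let ?P = "\<lambda>i. iter_integral (replicate i z)"
  show ?case
  proof (cases "a = 0 \<or> b = 0")
    case False
    then obtain a' b' where ab: "a = Suc a'" "b = Suc b'" by (meson not0_implies_Suc)
    have n: "n = a' + b" "n = a + b'" using Suc.hyps ab by auto
    show ?thesis
    proof (rule primitive_unique[OF _ _ \<open>0 < t\<close>])
      show "primitive t (\<lambda>s. ?P a s * ?P b s)
          (\<lambda>s. z (of_real s) * ?P a' s * ?P b s + ?P a s * (z (of_real s) * ?P b' s))"
        unfolding ab by (intro primitive_mult primitive_replicate Suc.prems) (auto simp: ab)
      show "primitive t (\<lambda>s. of_nat ((a + b) choose a) * ?P (a + b) s)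
          (\<lambda>s. of_nat ((a + b) choose a) * (z (of_real s) * ?P n s))"
        unfolding Suc.hyps(2)[symmetric]
        by (intro primitive_cmult primitive_replicate Suc.prems) (auto simp: Suc.hyps)
      have "z (of_real s) * ?P a' s * ?P b s + ?P a s * (z (of_real s) * ?P b' s)
          = of_nat ((a + b) choose a) * (z (of_real s) * ?P n s)" if s: "s \<in> {0<..<t}" for s
      proof -
        have conv: "iter_converges (replicate i z) s" if "i \<le> a + b" for i
          using iter_converges_mono[OF Suc.prems(2)[OF that]] s by simp
        have "?P a' s * ?P b s = of_nat (n choose a') * ?P n s"
          using Suc.hyps(1)[OF n(1), of s] s conv by (simp add: n(1) ab)
        moreover have "?P a s * ?P b' s = of_nat (n choose a) * ?P n s"
          using Suc.hyps(1)[OF n(2), of s] s conv n(2) ab by simp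
        moreover have "(a + b) choose a = (n choose a') + (n choose a)"
          by (metis Suc.hyps(2) ab(1) binomial_Suc_Suc)
        ultimately show ?thesis by (simp add: algebra_simps)
      qed
      then show "AE s in lborel. s \<in> {0<..<t} \<longrightarrow>
          z (of_real s) * ?P a' s * ?P b s + ?P a s * (z (of_real s) * ?P b' s)
          = of_nat ((a + b) choose a) * (z (of_real s) * ?P n s)" by simp
    qed
  qed auto
qed auto

section \<open>The alternating relation and its inversion\<close>

lemma sum_alternating_choose_Suc:
  "1 \<le> r \<Longrightarrow> (\<Sum>j<r. (-1) ^ j * of_nat (r choose Suc j)) = (1::'a::comm_ring_1)"
proof -
  assume "1 \<le> r"
  then have "0 = (\<Sum>i\<le>r. (-1) ^ i * of_nat (r choose i) :: 'a)"
    by (subst choose_alternating_sum) auto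
  also have "\<dots> = 1 - (\<Sum>j<r. (-1) ^ j * of_nat (r choose Suc j))"
    by (simp add: lessThan_Suc_atMost[symmetric] sum.lessThan_Suc_shift sum_negf del: sum.lessThan_Suc)
  finally show ?thesis by (simp add: algebra_simps)
qed

text \<open>Induction on the number \<open>m\<close> of letters \<open>z0\<close>, with the index
  \<open>j\<close> shifted to start at 0. For \<open>m = 0\<close> every factor is a power of
  \<open>z\<close>, and the claim becomes the alternating sum of binomial coefficients.\<close>

lemma iter_integral_eq_comp_sum:
  assumes "1 \<le> r" "0 < t"
    and "\<And>j. j < r \<Longrightarrow> comp_converges z z0 (Suc j) m t"
    and "\<And>i. i < r \<Longrightarrow> iter_converges (replicate i z) t"
  shows "iter_integral (replicate r z @ replicate m z0) t =
    (\<Sum>j<r. (-1) ^ j * (iter_integral (replicate (r - Suc j) z) t * comp_sum z z0 (Suc j) m t))"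
  using assms
proof (induction m arbitrary: t)
  case 0
  have "iter_converges (replicate i z) t" if "i \<le> r" for i
    using that 0 comp_converges_ones[OF 0(3)[of "r - 1"]] by (cases "i = r") auto
  then have "iter_integral (replicate (r - Suc j) z) t * iter_integral (replicate (Suc j) z) t
      = of_nat (r choose Suc j) * iter_integral (replicate r z) t" if "j < r" for j
    using iter_integral_replicate_mult[OF \<open>0 < t\<close>, of "r - Suc j" "Suc j" z] that
    by (simp add: binomial_symmetric[of "Suc j" r])
  then have "(\<Sum>j<r. (-1) ^ j * (iter_integral (replicate (r - Suc j) z) t * comp_sum z z0 (Suc j) 0 t))
      = (\<Sum>j<r. (-1) ^ j * of_nat (r choose Suc j)) * iter_integral (replicate r z) t"
    unfolding comp_sum_0_right sum_distrib_right by (intro sum.cong) auto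
  then show ?case using 0 by (simp add: sum_alternating_choose_Suc)
next
  case (Suc m)
  let ?P = "\<lambda>i. iter_integral (replicate i z)" and ?E = "comp_sum z z0"
  \<comment> \<open>The density of \<open>?P i\<close>. For \<open>i = 0\<close> it is 0: there
    \<open>?P 0\<close> is the constant 1, and the product rule below reduces to the assumption on
    \<open>F\<close>.\<close>
  define dP where "dP i s = (case i of 0 \<Rightarrow> 0 | Suc l \<Rightarrow> z (of_real s) * ?P l s)" for i s
  have prim_mult_P: "primitive t (\<lambda>s. ?P i s * F s) (\<lambda>s. dP i s * F s + ?P i s * f s)"
    if "primitive t F f" "iter_converges (replicate i z) t" for i F f
    using that primitive_mult[OF primitive_replicate] by (cases i) (auto simp: dP_def)
  obtain r' where r: "r = Suc r'" using \<open>1 \<le> r\<close> by (cases r) auto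
  show ?case
  proof (rule primitive_unique[OF _ _ \<open>0 < t\<close>])
    have word: "replicate r z @ replicate (Suc m) z0 = (replicate r z @ replicate m z0) @ [z0]"
      by (simp add: replicate_append_same)
    have "iter_converges (replicate r z @ replicate (Suc m) z0) t"
      using comp_converges_ones[OF Suc.prems(3)[of r']] r by simp
    then show "primitive t (iter_integral (replicate r z @ replicate (Suc m) z0))
        (\<lambda>s. z0 (of_real s) * iter_integral (replicate r z @ replicate m z0) s)"
      unfolding word by (rule primitive_iter_integral)
    show "primitive t (\<lambda>s. \<Sum>j<r. (-1) ^ j * (?P (r - Suc j) s * ?E (Suc j) (Suc m) s))
        (\<lambda>s. \<Sum>j<r. (-1) ^ j * (dP (r - Suc j) s * ?E (Suc j) (Suc m) s + ?P (r - Suc j) s *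
          (z (of_real s) * ?E j (Suc m) s + z0 (of_real s) * ?E (Suc j) m s)))"
      using Suc.prems by (intro primitive_sum primitive_cmult prim_mult_P primitive_comp_sum) auto
    \<comment> \<open>The induction hypothesis at \<open>s\<close> needs convergence for
      \<open>m\<close>, which is known only for almost every \<open>s\<close> with
      \<open>z0 s\<close> nonzero; where \<open>z0 s = 0\<close>, both sides of its multiple by
      \<open>z0 s\<close> vanish.\<close>
    have "AE s in lborel. \<forall>j\<in>{..<r}.
        s \<in> {0<..<t} \<longrightarrow> z0 (of_real s) = 0 \<or> comp_converges z z0 (Suc j) m s"
      using Suc.prems by (intro AE_finite_allI comp_converges_AE) auto
    then show "AE s in lborel. s \<in> {0<..<t} \<longrightarrow>
        z0 (of_real s) * iter_integral (replicate r z @ replicate m z0) s =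
        (\<Sum>j<r. (-1) ^ j * (dP (r - Suc j) s * ?E (Suc j) (Suc m) s + ?P (r - Suc j) s *
          (z (of_real s) * ?E j (Suc m) s + z0 (of_real s) * ?E (Suc j) m s)))"
    proof eventually_elim
      fix s assume conv: "\<forall>j\<in>{..<r}. s \<in> {0<..<t} \<longrightarrow> z0 (of_real s) = 0 \<or> comp_converges z z0 (Suc j) m s"
      show "s \<in> {0<..<t} \<longrightarrow>
        z0 (of_real s) * iter_integral (replicate r z @ replicate m z0) s =
        (\<Sum>j<r. (-1) ^ j * (dP (r - Suc j) s * ?E (Suc j) (Suc m) s + ?P (r - Suc j) s *
          (z (of_real s) * ?E j (Suc m) s + z0 (of_real s) * ?E (Suc j) m s)))"
      proof
        assume s: "s \<in> {0<..<t}"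
        have "z0 (of_real s) * iter_integral (replicate r z @ replicate m z0) s =
            z0 (of_real s) * (\<Sum>j<r. (-1) ^ j * (?P (r - Suc j) s * ?E (Suc j) m s))"
          using Suc.IH[of s] Suc.prems s conv iter_converges_mono[OF Suc.prems(4), of _ s]
          by (cases "z0 (of_real s) = 0") auto
        moreover have "(\<Sum>j<r. (-1) ^ j * (dP (r - Suc j) s * ?E (Suc j) (Suc m) s)) =
            (\<Sum>j<r'. (-1) ^ j * (z (of_real s) * ?P (r' - Suc j) s * ?E (Suc j) (Suc m) s))"
        proof -
          have "dP (r - Suc j) s = z (of_real s) * ?P (r' - Suc j) s" if "j < r'" for j
          proof -
            have "r - Suc j = Suc (r' - Suc j)" using that r by simp
            then show ?thesis by (simp add: dP_def)
          qed
          \<comment> \<open>The last term carries the constant \<open>?P 0\<close>, so only the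
            terms with \<open>j < r'\<close> remain.\<close>
          moreover have "dP (r - Suc r') s = 0" by (simp add: r dP_def)
          ultimately show ?thesis
            unfolding sum.lessThan_Suc[of _ r', folded r] by simp
        qed
        \<comment> \<open>The term \<open>j = 0\<close> vanishes because \<open>?E 0 (Suc m)\<close>
          is an empty sum. Shifting \<open>j\<close> by one changes the sign, so this sum cancels
          the previous one.\<close>
        moreover have "(\<Sum>j<r. (-1) ^ j * (?P (r - Suc j) s * (z (of_real s) * ?E j (Suc m) s))) =
            - (\<Sum>j<r'. (-1) ^ j * (z (of_real s) * ?P (r' - Suc j) s * ?E (Suc j) (Suc m) s))"
          unfolding r sum.lessThan_Suc_shift by (simp add: comp_sum_0_Suc sum_negf mult_ac)
        moreover have "(\<Sum>j<r. (-1) ^ j * (dP (r - Suc j) s * ?E (Suc j) (Suc m) s + ?P (r - Suc j) s *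
            (z (of_real s) * ?E j (Suc m) s + z0 (of_real s) * ?E (Suc j) m s))) =
            (\<Sum>j<r. (-1) ^ j * (dP (r - Suc j) s * ?E (Suc j) (Suc m) s)) +
            (\<Sum>j<r. (-1) ^ j * (?P (r - Suc j) s * (z (of_real s) * ?E j (Suc m) s))) +
            z0 (of_real s) * (\<Sum>j<r. (-1) ^ j * (?P (r - Suc j) s * ?E (Suc j) m s))"
          unfolding sum_distrib_left sum.distrib[symmetric]
          by (intro sum.cong refl) (simp add: algebra_simps)
        ultimately show "z0 (of_real s) * iter_integral (replicate r z @ replicate m z0) s =
          (\<Sum>j<r. (-1) ^ j * (dP (r - Suc j) s * ?E (Suc j) (Suc m) s + ?P (r - Suc j) s *
            (z (of_real s) * ?E j (Suc m) s + z0 (of_real s) * ?E (Suc j) m s)))"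
          by simp
      qed
    qed
  qed
qed

text \<open>In terms of power series modulo X^r: the series with coefficients
  \<open>S (Suc q)\<close> is the product of A(X), with coefficients \<open>P n\<close>, and the
  series with coefficients \<open>(-1) ^ i * E (Suc i)\<close>. By the hypothesis on
  \<open>P\<close>, A behaves like an exponential series, so its inverse is A(-X).\<close>

lemma alternating_convolution_inverse:
  fixes P S E :: "nat \<Rightarrow> 'a::comm_ring_1"
  assumes S: "\<And>q. q < r \<Longrightarrow> S (Suc q) = (\<Sum>i\<le>q. (-1) ^ i * (P (q - i) * E (Suc i)))"
    and P: "\<And>a b. a + b < r \<Longrightarrow> P a * P b = of_nat ((a + b) choose a) * P (a + b)" and "P 0 = 1"
    and "1 \<le> r"
  shows "E r = (\<Sum>j<r. (-1) ^ j * (P (r - Suc j) * S (Suc j)))"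
proof -
  obtain q where r: "r = Suc q" using \<open>1 \<le> r\<close> by (cases r) auto
  \<comment> \<open>The coefficients of A(-X) A(X) = 1.\<close>
  have inner: "(\<Sum>l\<le>n. (-1) ^ l * (P (n - l) * P l)) = (if n = 0 then 1 else 0)" if "n < r" for n
  proof -
    have "P (n - l) * P l = of_nat (n choose l) * P n" if "l \<le> n" for l
      using P[of l "n - l"] \<open>n < r\<close> that by (simp add: mult.commute)
    then have "(\<Sum>l\<le>n. (-1) ^ l * (P (n - l) * P l)) = (\<Sum>l\<le>n. (-1) ^ l * of_nat (n choose l)) * P n"
      unfolding sum_distrib_right by (intro sum.cong) (auto simp: mult.assoc)
    then show ?thesis using \<open>P 0 = 1\<close> by (auto simp: choose_alternating_sum)
  qed
  have "(\<Sum>j<r. (-1) ^ j * (P (r - Suc j) * S (Suc j))) =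
      (\<Sum>j\<le>q. \<Sum>i\<le>j. (-1) ^ (j - i) * (P (q - j) * P (j - i)) * E (Suc i))"
    unfolding r lessThan_Suc_atMost
  proof (intro sum.cong refl)
    fix j assume "j \<in> {..q}"
    then have "(-1) ^ j * (P (q - j) * S (Suc j)) =
        (\<Sum>i\<le>j. ((-1) ^ j * (-1) ^ i) * (P (q - j) * P (j - i)) * E (Suc i))"
      by (simp add: S r sum_distrib_left mult_ac)
    also have "\<dots> = (\<Sum>i\<le>j. (-1) ^ (j - i) * (P (q - j) * P (j - i)) * E (Suc i))"
    proof (intro sum.cong refl)
      fix i assume "i \<in> {..j}"
      then have "(-1::'a) ^ j * (-1) ^ i = (-1) ^ (j - i)"
        by (auto simp flip: power_add simp: minus_one_power_iff)
      then show "((-1) ^ j * (-1) ^ i) * (P (q - j) * P (j - i)) * E (Suc i) =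
          (-1) ^ (j - i) * (P (q - j) * P (j - i)) * E (Suc i)" by simp
    qed
    finally show "(-1) ^ j * (P (Suc q - Suc j) * S (Suc j)) =
        (\<Sum>i\<le>j. (-1) ^ (j - i) * (P (q - j) * P (j - i)) * E (Suc i))" by simp
  qed
  \<comment> \<open>The order of summation over the triangle \<open>i \<le> j \<le> q\<close> is
    exchanged; then \<open>l = j - i\<close> turns the inner sum into a coefficient computed in
    \<open>inner\<close>.\<close>
  also have "\<dots> = (\<Sum>i\<le>q. \<Sum>j\<in>{i..q}. (-1) ^ (j - i) * (P (q - j) * P (j - i)) * E (Suc i))"
    by (subst sum.Sigma, simp, simp, subst sum.Sigma, simp, simp)
      (rule sum.reindex_bij_witness[of _ "\<lambda>(i, j). (j, i)" "\<lambda>(j, i). (i, j)"], auto)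
  also have "\<dots> = (\<Sum>i\<le>q. (\<Sum>l\<le>q - i. (-1) ^ l * (P (q - i - l) * P l)) * E (Suc i))"
    unfolding sum_distrib_right
  proof (rule sum.cong[OF refl])
    fix i assume i: "i \<in> {..q}"
    show "(\<Sum>j\<in>{i..q}. (-1) ^ (j - i) * (P (q - j) * P (j - i)) * E (Suc i)) =
        (\<Sum>l\<le>q - i. (-1) ^ l * (P (q - i - l) * P l) * E (Suc i))"
      using i by (intro sum.reindex_bij_witness[of _ "\<lambda>l. l + i" "\<lambda>j. j - i"]) auto
  qed
  also have "\<dots> = (\<Sum>i\<le>q. if i = q then E (Suc i) else 0)"
  proof (rule sum.cong[OF refl])
    fix i assume "i \<in> {..q}"
    then show "(\<Sum>l\<le>q - i. (-1) ^ l * (P (q - i - l) * P l)) * E (Suc i) = (if i = q then E (Suc i) else 0)"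
      by (subst inner) (auto simp: r)
  qed
  also have "\<dots> = E r" by (simp add: r)
  finally show ?thesis by simp
qed

section \<open>Meromorphic functions on the real line and convergence of prefixes\<close>

text \<open>A sparse set of complex numbers is countable, so its real points form a null
  set.\<close>

lemma AE_lborel_of_cosparse:
  assumes "eventually P (cosparse (UNIV :: complex set))"
  shows "AE s in lborel. P (of_real s)"
proof (rule AE_I')
  have "countable {w. \<not> P w}"
    using assms sparse_imp_countable[of UNIV "{w. \<not> P w}"] by (simp add: eventually_cosparse)
  then have "countable (complex_of_real -` {w. \<not> P w})"
    by (intro countable_image_inj_on[OF countable_subset[OF image_vimage_subset]])
      (auto simp: inj_on_def)
  then show "complex_of_real -` {w. \<not> P w} \<in> null_sets lborel"
    by (rule countable_imp_null_set_lborel)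
qed auto

lemma meromorphic_AE_zero_or_nonzero:
  assumes "z meromorphic_on UNIV"
  shows "(AE s in lborel. z (of_real s) = 0) \<or> (AE s in lborel. z (of_real s) \<noteq> 0)"
  using meromorphic_imp_constant_or_avoid[OF assms, of 0]
  by (auto intro: AE_lborel_of_cosparse[of "\<lambda>w. z w = 0"] AE_lborel_of_cosparse[of "\<lambda>w. z w \<noteq> 0"])

text \<open>Descending induction. Fubini says nothing about the single point \<open>t\<close>, so
  the longer word is taken up to some \<open>t'\<close> beyond \<open>t\<close>. The interval
  between them has positive measure and hence contains a point where the prefix converges, and
  convergence passes down from there to \<open>t\<close>.\<close>

lemma iter_converges_replicate_le:
  assumes nz: "AE s in lborel. z (of_real s) \<noteq> 0"
    and conv: "\<And>t. t \<in> {0<..<x} \<Longrightarrow> iter_converges (replicate n z) t"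
    and "i \<le> n" "t \<in> {0<..<x}"
  shows "iter_converges (replicate i z) t"
  using \<open>i \<le> n\<close> \<open>t \<in> {0<..<x}\<close>
proof (induction i arbitrary: t rule: inc_induct)
  case (step i)
  obtain t' where t': "t < t'" "t' < x" using dense[of t x] step.prems by auto
  then have "iter_converges (replicate i z @ [z]) t'"
    using step.IH[of t'] step.prems by (simp add: replicate_append_same)
  from iter_converges_snoc_AE[OF this] nz
  have "AE s in lborel. s \<in> {t<..<t'} \<longrightarrow> iter_converges (replicate i z) s"
    by eventually_elim (use step.prems in auto)
  moreover have "\<not> (AE s in lborel. s \<notin> {t<..<t'})"
    using t' by (subst AE_iff_measurable[of "{t<..<t'}"]) auto
  ultimately have "\<exists>s\<in>{t<..<t'}. iter_converges (replicate i z) s"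
    by (metis (mono_tags, lifting) eventually_mono)
  then obtain s where "s \<in> {t<..<t'}" "iter_converges (replicate i z) s" by blast
  then show ?case using iter_converges_mono by fastforce
qed (use conv in auto)

text \<open>The density of the outermost integral vanishes almost everywhere: either the last letter
  \<open>g\<close> is \<open>z\<close>, or \<open>z\<close> occurs in the prefix. In the latter
  case, \<open>g s = 0\<close> or the prefix converges up to \<open>s\<close> and the induction
  hypothesis applies.\<close>

lemma iter_integral_eq_0:
  assumes "AE s in lborel. z (of_real s) = 0" "iter_converges fs t" "z \<in> set fs"
  shows "iter_integral fs t = 0"
  using assms(2,3)
proof (induction fs arbitrary: t rule: rev_induct)
  case (snoc g fs)
  have "AE s in lborel. indicator {0<..<t} s *\<^sub>R (g (of_real s) * iter_integral fs s) = 0"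
    using iter_converges_snoc_AE[OF snoc.prems(1)] assms(1)
  proof eventually_elim
    fix s assume "s \<in> {0<..<t} \<longrightarrow> g (of_real s) = 0 \<or> iter_converges fs s" "z (of_real s) = 0"
    then show "indicator {0<..<t} s *\<^sub>R (g (of_real s) * iter_integral fs s) = 0"
      using snoc.IH[of s] snoc.prems(2) by (cases "z \<in> set fs") (auto simp: indicator_def)
  qed
  then show ?case
    unfolding iter_integral_snoc[OF snoc.prems(1)] set_lebesgue_integral_def
    by (rule integral_eq_zero_AE)
qed auto

section \<open>The identities between the integrands\<close>

text \<open>Both formulas before integration, with the common factor \<open>z0 t\<close> removed. If
  \<open>z\<close> vanishes almost everywhere, so does every term, since all words of
  \<open>S\<close> and \<open>E\<close> contain \<open>z\<close>. Otherwise all shorter powers of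
  \<open>z\<close> converge, and multiplying the relation and its inverse by \<open>P p t\<close>
  produces the binomial coefficients.\<close>

lemma AK_identities_pointwise:
  fixes z z0 :: "complex \<Rightarrow> complex" and r p m :: nat
  defines "P \<equiv> \<lambda>i. iter_integral (replicate i z)"
    and "S \<equiv> \<lambda>j. iter_integral (replicate j z @ replicate m z0)"
    and "E \<equiv> \<lambda>j. comp_sum z z0 j m"
  assumes "z meromorphic_on UNIV" "1 \<le> r" "t \<in> {0<..<x}"
    and conv: "\<And>j t. j < r \<Longrightarrow> t \<in> {0<..<x} \<Longrightarrow> comp_converges z z0 (Suc j) m t"
    and convP: "\<And>t. t \<in> {0<..<x} \<Longrightarrow> iter_converges (replicate (p + r - 1) z) t"
  shows "P p t * S r t =
      (\<Sum>j<r. (-1) ^ j * of_nat ((p + r - Suc j) choose p) * (P (p + r - Suc j) t * E (Suc j) t))" (is ?A)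
    and "P p t * E r t =
      (\<Sum>j<r. (-1) ^ j * of_nat ((p + r - Suc j) choose p) * (P (p + r - Suc j) t * S (Suc j) t))" (is ?B)
proof -
  consider "AE s in lborel. z (of_real s) = 0" | "AE s in lborel. z (of_real s) \<noteq> 0"
    using meromorphic_AE_zero_or_nonzero[OF assms(4)] by blast
  then have "?A \<and> ?B"
  proof cases
    case 1
    have "E (Suc j) t = 0" if "j < r" for j
      unfolding E_def comp_sum_def
    proof (intro sum.neutral ballI iter_integral_eq_0[OF 1])
      fix ks assume ks: "ks \<in> compositions (Suc j) (m + Suc j)"
      then show "iter_converges (comp_word z z0 ks) t"
        using conv[OF that \<open>t \<in> _\<close>] by (simp add: comp_converges_def)
      show "z \<in> set (comp_word z z0 ks)"
        using ks by (cases ks) (auto simp: compositions_def comp_word_def)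
    qed
    moreover have "S (Suc j) t = 0" if "j < r" for j
      unfolding S_def using comp_converges_ones[OF conv[OF that \<open>t \<in> _\<close>]]
      by (intro iter_integral_eq_0[OF 1]) auto
    moreover obtain r' where "r = Suc r'" using \<open>1 \<le> r\<close> by (cases r) auto
    ultimately show ?thesis by simp
  next
    case 2
    have conv_z: "iter_converges (replicate i z) t" if "i \<le> p + r - 1" for i
      using iter_converges_replicate_le[OF 2 convP that \<open>t \<in> _\<close>] .
    have PP: "P a t * P b t = of_nat ((a + b) choose a) * P (a + b) t" if "a + b \<le> p + r - 1" for a b
      unfolding P_def using that \<open>t \<in> _\<close> by (intro iter_integral_replicate_mult conv_z) auto
    have S: "S (Suc q) t = (\<Sum>j\<le>q. (-1) ^ j * (P (q - j) t * E (Suc j) t))" if "q < r" for q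
      using iter_integral_eq_comp_sum[of "Suc q" t z z0 m] that \<open>t \<in> _\<close> conv conv_z
      by (simp add: P_def S_def E_def lessThan_Suc_atMost)
    have Sr: "S r t = (\<Sum>j<r. (-1) ^ j * (P (r - Suc j) t * E (Suc j) t))"
      using S[of "r - 1"] \<open>1 \<le> r\<close> by (cases r) (auto simp: lessThan_Suc_atMost)
    have Er: "E r t = (\<Sum>j<r. (-1) ^ j * (P (r - Suc j) t * S (Suc j) t))"
    proof (rule alternating_convolution_inverse[where E = "\<lambda>i. E i t"])
      show "P a t * P b t = of_nat ((a + b) choose a) * P (a + b) t" if "a + b < r" for a b
        using that by (intro PP) simp
      show "P 0 t = 1" by (simp add: P_def)
    qed (use S \<open>1 \<le> r\<close> in auto)
    \<comment> \<open>The sequence \<open>X\<close> is left arbitrary so that it can stand for the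
      values of \<open>E\<close> in the first formula and of \<open>S\<close> in the second.\<close>
    have "P p t * (\<Sum>j<r. (-1) ^ j * (P (r - Suc j) t * X j)) =
        (\<Sum>j<r. (-1) ^ j * of_nat ((p + r - Suc j) choose p) * (P (p + r - Suc j) t * X j))" for X
      unfolding sum_distrib_left
    proof (intro sum.cong refl)
      fix j assume "j \<in> {..<r}"
      then have eq: "P p t * P (r - Suc j) t = of_nat ((p + r - Suc j) choose p) * P (p + r - Suc j) t"
        using PP[of p "r - Suc j"] by simp
      have "P p t * ((-1) ^ j * (P (r - Suc j) t * X j)) = (-1) ^ j * ((P p t * P (r - Suc j) t) * X j)"
        by (simp only: mult_ac)
      then show "P p t * ((-1) ^ j * (P (r - Suc j) t * X j)) =
          (-1) ^ j * of_nat ((p + r - Suc j) choose p) * (P (p + r - Suc j) t * X j)"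
        by (simp only: eq mult.assoc)
    qed
    then show ?thesis using Sr Er by simp
  qed
  then show ?A ?B by auto
qed

section \<open>Integration over \<open>t\<close>\<close>

lemma
  fixes f :: "'i \<Rightarrow> 'a \<Rightarrow> 'b::{banach, second_countable_topology}"
  assumes "\<And>i. i \<in> I \<Longrightarrow> set_integrable M A (f i)"
  shows set_integrable_sum: "set_integrable M A (\<lambda>t. \<Sum>i\<in>I. f i t)"
    and set_integral_sum: "(LINT t:A|M. \<Sum>i\<in>I. f i t) = (\<Sum>i\<in>I. LINT t:A|M. f i t)"
  using assms by (simp_all add: set_lebesgue_integral_def set_integrable_def scaleR_sum_right)

lemma sum_atLeastAtMost_1_eq: "(\<Sum>j=1..r. f j) = (\<Sum>j<r. f (Suc j))"
  by (rule sum.reindex_bij_witness[of _ Suc "\<lambda>j. j - 1"]) auto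

lemma formal_polylog_converges_compositions:
  "ks \<in> compositions j n \<Longrightarrow>
    formal_polylog_converges z0 (replicate j z) ks t \<longleftrightarrow> iter_converges (comp_word z z0 ks) t"
  by (simp add: formal_polylog_converges_def polylog_word_replicate compositions_def)

lemma AK_integrand_compositions:
  "ks \<in> compositions j n \<Longrightarrow> AK_integrand z0 (replicate j z) ks z p t =
    iter_integral (replicate p z) t * z0 (of_real t) * iter_integral (comp_word z z0 ks) t"
  by (simp add: AK_integrand_def formal_polylog_def polylog_word_replicate comp_word_replicate compositions_def)

theorem theorem3p4:
  fixes k r p :: nat and z z0 :: "complex \<Rightarrow> complex" and x :: real
  assumes "1 \<le> k" and "1 \<le> r"
    and "log_sing_meromorphic z" and "log_sing_meromorphic z0"
    and "0 < x"
    and "\<And>j ks. j \<in> {1..r} \<Longrightarrow> ks \<in> compositions j (k + j - 1) \<Longrightarrow>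
           AK_converges z0 x (replicate j z) ks z (p + r - j)"
  shows "AK_zeta z0 x (replicate r z) (replicate (r - 1) 1 @ [k]) z p =
           (\<Sum>j=1..r. \<Sum>ks\<in>compositions j (k + j - 1).
              (-1) ^ (j - 1) * of_nat ((p + r - j) choose p)
                * AK_zeta z0 x (replicate j z) ks z (p + r - j))
       \<and> (\<Sum>ks\<in>compositions r (k + r - 1). AK_zeta z0 x (replicate r z) ks z p) =
           (\<Sum>j=1..r. (-1) ^ (j - 1) * of_nat ((p + r - j) choose p)
              * AK_zeta z0 x (replicate j z) (replicate (j - 1) 1 @ [k]) z (p + r - j))"
proof -
  obtain m where k: "k = Suc m" using \<open>1 \<le> k\<close> by (cases k) auto
  obtain r' where r: "r = Suc r'" using \<open>1 \<le> r\<close> by (cases r) auto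
  have mero: "z meromorphic_on UNIV" using assms(3) by (simp add: log_sing_meromorphic_def)
  let ?C = "\<lambda>j. compositions (Suc j) (m + Suc j)" and ?k = "\<lambda>j. replicate j 1 @ [Suc m]"
  let ?f = "\<lambda>j ks. AK_integrand z0 (replicate (Suc j) z) ks z (p + r - Suc j)"
  let ?c = "\<lambda>j. (-1) ^ j * of_nat ((p + r - Suc j) choose p) :: complex"
  have AK: "AK_converges z0 x (replicate (Suc j) z) ks z (p + r - Suc j)" if "j < r" "ks \<in> ?C j" for j ks
    using assms(6)[of "Suc j" ks] that by (simp add: k)
  have ones: "?k j \<in> ?C j" for j
    using ones_k_in_compositions[of "Suc j" "Suc m"] by simp
  have conv: "comp_converges z z0 (Suc j) m t" if "j < r" "t \<in> {0<..<x}" for j t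
    unfolding comp_converges_def
  proof
    fix ks assume ks: "ks \<in> ?C j"
    then show "iter_converges (comp_word z z0 ks) t"
      using AK[OF that(1) ks] that(2)
      unfolding AK_converges_def formal_polylog_converges_compositions[OF ks] by blast
  qed
  \<comment> \<open>The hypothesis for \<open>j = 1\<close> has \<open>p + r - 1\<close> entries in
    the right column, the longest power of \<open>z\<close> that occurs there.\<close>
  have convP: "iter_converges (replicate (p + r - 1) z) t" if "t \<in> {0<..<x}" for t
    using AK[OF _ ones, of 0] that r
    by (simp add: AK_converges_def formal_polylog_converges_def polylog_word_ones[simplified])
  have int: "set_integrable lborel {0<..<x} (?f j ks)" if "j < r" "ks \<in> ?C j" for j ks
    using AK[OF that] by (simp add: AK_converges_def)
  have zeta: "AK_zeta z0 x (replicate (Suc j) z) ks z (p + r - Suc j) = (LINT t:{0<..<x}|lborel. ?f j ks t)" for j ks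
    by (simp add: AK_zeta_def)
  have sum_C: "(\<Sum>ks\<in>?C j. AK_integrand z0 (replicate (Suc j) z) ks z q t) =
      iter_integral (replicate q z) t * z0 (of_real t) * comp_sum z z0 (Suc j) m t" for j q t
    unfolding comp_sum_def sum_distrib_left by (intro sum.cong refl AK_integrand_compositions)
  have at_ones: "AK_integrand z0 (replicate (Suc j) z) (?k j) z q t =
      iter_integral (replicate q z) t * z0 (of_real t) * iter_integral (replicate (Suc j) z @ replicate m z0) t" for j q t
    using comp_word_ones_snoc[of z z0 j m] unfolding AK_integrand_compositions[OF ones] by simp
  have pw1: "iter_integral (replicate p z) t * iter_integral (replicate r z @ replicate m z0) t =
      (\<Sum>j<r. ?c j * (iter_integral (replicate (p + r - Suc j) z) t * comp_sum z z0 (Suc j) m t))"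
    if "t \<in> {0<..<x}" for t
    by (rule AK_identities_pointwise(1)[OF mero \<open>1 \<le> r\<close> that]) (rule conv convP, assumption+)+
  have pw2: "iter_integral (replicate p z) t * comp_sum z z0 r m t =
      (\<Sum>j<r. ?c j * (iter_integral (replicate (p + r - Suc j) z) t *
        iter_integral (replicate (Suc j) z @ replicate m z0) t))"
    if "t \<in> {0<..<x}" for t
    by (rule AK_identities_pointwise(2)[OF mero \<open>1 \<le> r\<close> that]) (rule conv convP, assumption+)+
  have factor: "(\<Sum>j<r. ?c j * (a j * w * b j)) = w * (\<Sum>j<r. ?c j * (a j * b j))" for a b :: "nat \<Rightarrow> complex" and w
    unfolding sum_distrib_left by (intro sum.cong refl) (simp only: mult_ac)
  \<comment> \<open>The index \<open>r'\<close> stands for \<open>j = r\<close>, where the right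
    column has length \<open>p\<close>; so both left-hand sides are built from members of the family
    \<open>?f\<close>, and the convergence hypotheses cover them too.\<close>
  have pr: "p + r - Suc r' = p" by (simp add: r)

  have "(LINT t:{0<..<x}|lborel. ?f r' (?k r') t) = (LINT t:{0<..<x}|lborel. \<Sum>j<r. \<Sum>ks\<in>?C j. ?c j * ?f j ks t)"
  proof (intro set_lebesgue_integral_cong allI impI)
    fix t assume t: "t \<in> {0<..<x}"
    show "?f r' (?k r') t = (\<Sum>j<r. \<Sum>ks\<in>?C j. ?c j * ?f j ks t)"
      unfolding at_ones sum_distrib_left[symmetric] sum_C factor pw1[OF t, symmetric] pr
      unfolding r by (simp only: mult_ac)
  qed simp
  also have "\<dots> = (\<Sum>j<r. \<Sum>ks\<in>?C j. ?c j * (LINT t:{0<..<x}|lborel. ?f j ks t))"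
  proof -
    have "(LINT t:{0<..<x}|lborel. \<Sum>j<r. \<Sum>ks\<in>?C j. ?c j * ?f j ks t) =
        (\<Sum>j<r. LINT t:{0<..<x}|lborel. \<Sum>ks\<in>?C j. ?c j * ?f j ks t)"
      by (intro set_integral_sum set_integrable_sum set_integrable_mult_right int) auto
    also have "\<dots> = (\<Sum>j<r. \<Sum>ks\<in>?C j. LINT t:{0<..<x}|lborel. ?c j * ?f j ks t)"
      by (intro sum.cong refl set_integral_sum set_integrable_mult_right int) auto
    finally show ?thesis by (simp only: set_integral_mult_right)
  qed
  finally have A: "AK_zeta z0 x (replicate r z) (?k r') z p =
      (\<Sum>j<r. \<Sum>ks\<in>?C j. ?c j * AK_zeta z0 x (replicate (Suc j) z) ks z (p + r - Suc j))"
    unfolding zeta[symmetric] unfolding pr by (simp add: r)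

  have "(\<Sum>ks\<in>?C r'. LINT t:{0<..<x}|lborel. ?f r' ks t) = (LINT t:{0<..<x}|lborel. \<Sum>ks\<in>?C r'. ?f r' ks t)"
    using int[of r'] by (subst set_integral_sum) (auto simp: r)
  also have "\<dots> = (LINT t:{0<..<x}|lborel. \<Sum>j<r. ?c j * ?f j (?k j) t)"
  proof (intro set_lebesgue_integral_cong allI impI)
    fix t assume t: "t \<in> {0<..<x}"
    show "(\<Sum>ks\<in>?C r'. ?f r' ks t) = (\<Sum>j<r. ?c j * ?f j (?k j) t)"
      unfolding at_ones sum_C factor pw2[OF t, symmetric] pr
      unfolding r by (simp only: mult_ac)
  qed simp
  also have "\<dots> = (\<Sum>j<r. ?c j * (LINT t:{0<..<x}|lborel. ?f j (?k j) t))"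
    unfolding set_integral_mult_right[symmetric]
    by (intro set_integral_sum set_integrable_mult_right int ones) auto
  finally have B: "(\<Sum>ks\<in>?C r'. AK_zeta z0 x (replicate r z) ks z p) =
      (\<Sum>j<r. ?c j * AK_zeta z0 x (replicate (Suc j) z) (?k j) z (p + r - Suc j))"
    unfolding zeta[symmetric] unfolding pr by (simp add: r)

  show ?thesis
    using A B unfolding sum_atLeastAtMost_1_eq by (simp add: k r)
qed

end
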